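(* Let $B$ be a complete Boolean algebra. Then for all modal formulas $\varphi,\psi$ the following formulas belong to $T_H(M_B)$: (K) $\Box(\varphi\to\psi)\to(\Box\varphi\to\Box\psi)$; (Dual) $\neg\Diamond\varphi\leftrightarrow\Box\neg\varphi$; (B) $\varphi\to\Box\Diamond\varphi$; (.2) $\Diamond\Box\varphi\to\Box\Diamond\varphi$; ($5^\ast$) $\Diamond\Box\varphi\to\varphi$. Consequently, (DM) $\Box\bigl(\Box(\varphi\to\Box\varphi)\to\varphi\bigr)\to(\Diamond\Box\varphi\to\varphi)$ also belongs to $T_H(M_B)$.
   Context: Boolean-valued models. For a complete Boolean algebra $B$ (bottom $0$, top $1$, complement $a^\ast$, $a\to b:=a^\ast\vee b$), define by transfinite recursion $V^{(B)}_\alpha=\{x: x$ is a function, $\mathrm{ran}(x)\subseteq B$, and $\mathrm{dom}(x)\subseteq V^{(B)}_\xi$ for some $\xi<\alpha\}$ and $V^{(B)}=\bigcup_\alpha V^{(B)}_\alpha$. Let $L_\in$ be the first-order language of set theory and $L_B$ its expansion by a constant symbol for each element of $V^{(B)}$. The Boolean value $\llbracket\cdot\rrbracket_B$ of $L_B$-sentences is defined recursively by $\llbracket u\in v\rrbracket_B=\bigvee_{x\in\mathrm{dom}(v)}(v(x)\wedge\llbracket x=u\rrbracket_B)$, $\llbracket u=v\rrbracket_B=\bigwedge_{x\in\mathrm{dom}(u)}(u(x)\to\llbracket x\in v\rrbracket_B)\wedge\bigwedge_{y\in\mathrm{dom}(v)}(v(y)\to\llbracket y\in u\rrbracket_B)$,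 the Boolean operations for the connectives, and meets (resp. joins) over $V^{(B)}$ for $\forall$ (resp. $\exists$). Internal modal semantics. $\mathsf{Sent}_{\in}$ is the (countable) set of parameter-free $L_\in$-sentences; its elements are used as the atomic propositions of the propositional modal language with $\neg,\wedge,\vee,\to,\Box,\Diamond$. On $B$ let $aRb\iff a\wedge b\neq 0$. Satisfaction in $M_B=\langle B,R,\llbracket\cdot\rrbracket_B\rangle$ at states $b\in B$ (including $b=0$): $M_B,b\models p$ iff $b\le\llbracket p\rrbracket_B$ for $p\in\mathsf{Sent}_{\in}$; modal-language Boolean connectives are interpreted classically at each state; $M_B,b\models\Box\varphi$ iff $M_B,a\models\varphi$ for all $a\in B$ with $bRa$; $M_B,b\models\Diamond\varphi$ iff $M_B,a\models\varphi$ for some $a\in B$ with $bRa$. $T_H(M_B)$ is the set of modal formulas $\varphi$ with $M_B,b\models\varphi$ for all $b\in B$. *)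

theory Defs
  imports "HOL-Algebra.Complete_Lattice" "HOL-Library.Multiset"
begin

section \<open>The ambient universe of sets\<close>

text \<open>
  The class \<open>V\<close> of all sets is rendered as a type \<open>'v\<close> with a membership relation satisfying ZFC.
  Classes are HOL predicates, so separation, replacement and foundation are single axioms
  quantifying over all predicates and functions on the universe.
\<close>

locale ZFC_universe =
  fixes mem :: "'v \<Rightarrow> 'v \<Rightarrow> bool"  (infix \<open>\<epsilon>\<close> 50)
  assumes extensionality: "(\<And>z. z \<epsilon> x \<longleftrightarrow> z \<epsilon> y) \<Longrightarrow> x = y"
    and foundation: "P x \<Longrightarrow> \<exists>m. P m \<and> (\<forall>y. y \<epsilon> m \<longrightarrow> \<not> P y)"
    and pairing: "\<exists>z. \<forall>w. w \<epsilon> z \<longleftrightarrow> w = x \<or> w = y"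
    and union: "\<exists>z. \<forall>w. w \<epsilon> z \<longleftrightarrow> (\<exists>y. y \<epsilon> x \<and> w \<epsilon> y)"
    and powerset: "\<exists>z. \<forall>w. w \<epsilon> z \<longleftrightarrow> (\<forall>y. y \<epsilon> w \<longrightarrow> y \<epsilon> x)"
    and infinity: "\<exists>z. (\<exists>e. e \<epsilon> z \<and> (\<forall>w. \<not> w \<epsilon> e)) \<and>
                      (\<forall>y. y \<epsilon> z \<longrightarrow> (\<exists>s. s \<epsilon> z \<and> (\<forall>w. w \<epsilon> s \<longleftrightarrow> w \<epsilon> y \<or> w = y)))"
    and separation: "\<exists>z. \<forall>w. w \<epsilon> z \<longleftrightarrow> w \<epsilon> x \<and> P w"
    and replacement: "\<exists>z. \<forall>w. w \<epsilon> z \<longleftrightarrow> (\<exists>y. y \<epsilon> x \<and> w = F y)"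
    and choice: "(\<And>y. y \<epsilon> x \<Longrightarrow> \<exists>w. w \<epsilon> y) \<Longrightarrow>
                 (\<And>y y' w. y \<epsilon> x \<Longrightarrow> y' \<epsilon> x \<Longrightarrow> w \<epsilon> y \<Longrightarrow> w \<epsilon> y' \<Longrightarrow> y = y') \<Longrightarrow>
                 \<exists>c. \<forall>y. y \<epsilon> x \<longrightarrow> (\<exists>!w. w \<epsilon> y \<and> w \<epsilon> c)"
begin

definition empty :: 'v
  where "empty = (THE z. \<forall>w. \<not> w \<epsilon> z)"

definition upair :: "'v \<Rightarrow> 'v \<Rightarrow> 'v"
  where "upair x y = (THE z. \<forall>w. w \<epsilon> z \<longleftrightarrow> w = x \<or> w = y)"

definition opair :: "'v \<Rightarrow> 'v \<Rightarrow> 'v"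
  where "opair x y = upair (upair x x) (upair x y)"

definition is_function :: "'v \<Rightarrow> bool"
  where "is_function f \<longleftrightarrow>
    (\<forall>p. p \<epsilon> f \<longrightarrow> (\<exists>x y. p = opair x y)) \<and>
    (\<forall>x y y'. opair x y \<epsilon> f \<longrightarrow> opair x y' \<epsilon> f \<longrightarrow> y = y')"

definition dom :: "'v \<Rightarrow> 'v set"
  where "dom f = {x. \<exists>y. opair x y \<epsilon> f}"

definition ran :: "'v \<Rightarrow> 'v set"
  where "ran f = {y. \<exists>x. opair x y \<epsilon> f}"

definition app :: "'v \<Rightarrow> 'v \<Rightarrow> 'v"
  where "app f x = (THE y. opair x y \<epsilon> f)"

definition transitive :: "'v \<Rightarrow> bool"
  where "transitive x \<longleftrightarrow> (\<forall>y z. z \<epsilon> y \<longrightarrow> y \<epsilon> x \<longrightarrow> z \<epsilon> x)"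

definition Ord :: "'v \<Rightarrow> bool"
  where "Ord \<alpha> \<longleftrightarrow> transitive \<alpha> \<and> (\<forall>\<beta>. \<beta> \<epsilon> \<alpha> \<longrightarrow> transitive \<beta>)"

abbreviation mem_rel :: "('v \<times> 'v) set"
  where "mem_rel \<equiv> {(x, y). x \<epsilon> y}"

lemma wf_mem_rel: "wf mem_rel"
proof (rule wfI_min)
  fix x and Q :: "'v set"
  assume "x \<in> Q"
  then show "\<exists>z\<in>Q. \<forall>y. (y, z) \<in> mem_rel \<longrightarrow> y \<notin> Q"
    using foundation[of "\<lambda>x. x \<in> Q" x] by auto
qed

lemma empty_iff: "\<not> w \<epsilon> empty"
proof -
  obtain e where e: "\<forall>w. \<not> w \<epsilon> e" using infinity by blast
  have "\<forall>w. \<not> w \<epsilon> empty" unfolding empty_def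
    by (rule theI[of _ e]) (use e extensionality in blast)+
  then show ?thesis by blast
qed

lemma upair_iff: "w \<epsilon> upair x y \<longleftrightarrow> w = x \<or> w = y"
proof -
  obtain z where z: "\<forall>w. w \<epsilon> z \<longleftrightarrow> w = x \<or> w = y" using pairing by blast
  have "\<forall>w. w \<epsilon> upair x y \<longleftrightarrow> w = x \<or> w = y" unfolding upair_def
    by (rule theI[of _ z]) (use z extensionality in blast)+
  then show ?thesis by blast
qed

lemma upair_eq_iff: "upair a b = upair c d \<longleftrightarrow> a = c \<and> b = d \<or> a = d \<and> b = c"
proof
  assume "upair a b = upair c d"
  then have "w \<in> {a, b} \<longleftrightarrow> w \<in> {c, d}" for w
    using upair_iff[of w a b] upair_iff[of w c d] by simp
  then have "{a, b} = {c, d}" by (rule Set.set_eqI)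
  then show "a = c \<and> b = d \<or> a = d \<and> b = c" by (simp only: doubleton_eq_iff)
next
  assume *: "a = c \<and> b = d \<or> a = d \<and> b = c"
  show "upair a b = upair c d"
    by (rule extensionality) (use * in \<open>auto simp: upair_iff\<close>)
qed

lemma opair_eq_iff: "opair x y = opair x' y' \<longleftrightarrow> x = x' \<and> y = y'"
  by (simp only: opair_def upair_eq_iff) blast

lemma dom_mem_rel: "x \<in> dom v \<Longrightarrow> (x, v) \<in> mem_rel\<^sup>+"
proof -
  assume "x \<in> dom v"
  then obtain y where "opair x y \<epsilon> v" by (auto simp: dom_def)
  moreover have "x \<epsilon> upair x x" "upair x x \<epsilon> opair x y"
    by (simp_all add: opair_def upair_iff)
  ultimately show ?thesis
    by (meson CollectI case_prodI trancl.intros)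
qed

end


section \<open>Formulas\<close>

text \<open>The language of set theory, with variables named by natural numbers.\<close>

datatype fm =
    Mem nat nat
  | Eq nat nat
  | Neg fm
  | And fm fm
  | Or fm fm
  | Imp fm fm
  | All nat fm
  | Ex nat fm

primrec free_vars :: "fm \<Rightarrow> nat set"
  where
    "free_vars (Mem i j) = {i, j}"
  | "free_vars (Eq i j) = {i, j}"
  | "free_vars (Neg p) = free_vars p"
  | "free_vars (And p q) = free_vars p \<union> free_vars q"
  | "free_vars (Or p q) = free_vars p \<union> free_vars q"
  | "free_vars (Imp p q) = free_vars p \<union> free_vars q"
  | "free_vars (All i p) = free_vars p - {i}"
  | "free_vars (Ex i p) = free_vars p - {i}"

typedef sentence = "{p. free_vars p = {}}"
  by (rule exI[of _ "All 0 (Eq 0 0)"]) simp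

datatype modal =
    Atom sentence
  | MNeg modal  (\<open>\<^bold>\<not> _\<close> [80] 80)
  | MAnd modal modal  (infixr \<open>\<^bold>\<and>\<close> 75)
  | MOr modal modal  (infixr \<open>\<^bold>\<or>\<close> 70)
  | MImp modal modal  (infixr \<open>\<^bold>\<longrightarrow>\<close> 65)
  | Box modal  (\<open>\<^bold>\<box> _\<close> [80] 80)
  | Dia modal  (\<open>\<^bold>\<diamond> _\<close> [80] 80)

abbreviation MIff :: "modal \<Rightarrow> modal \<Rightarrow> modal"  (infix \<open>\<^bold>\<longleftrightarrow>\<close> 60)
  where "\<phi> \<^bold>\<longleftrightarrow> \<psi> \<equiv> (\<phi> \<^bold>\<longrightarrow> \<psi>) \<^bold>\<and> (\<psi> \<^bold>\<longrightarrow> \<phi>)"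


section \<open>Boolean-valued models\<close>

text \<open>
  The type class \<^class>\<open>complete_boolean_algebra\<close> is not usable here: it requires complete
  distributivity, which would restrict attention to atomic algebras.
\<close>

locale complete_Boolean_algebra = complete_lattice B for B (structure) +
  assumes distrib: "\<lbrakk>x \<in> carrier B; y \<in> carrier B; z \<in> carrier B\<rbrakk>
      \<Longrightarrow> x \<sqinter> (y \<squnion> z) = (x \<sqinter> y) \<squnion> (x \<sqinter> z)"
    and complement_exists: "x \<in> carrier B
      \<Longrightarrow> \<exists>y \<in> carrier B. x \<sqinter> y = \<bottom> \<and> x \<squnion> y = \<top>"
begin

definition compl :: "'a \<Rightarrow> 'a"
  where "compl x = (THE y. y \<in> carrier B \<and> x \<sqinter> y = \<bottom> \<and> x \<squnion> y = \<top>)"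

definition impl :: "'a \<Rightarrow> 'a \<Rightarrow> 'a"
  where "impl x y = compl x \<squnion> y"

lemma compl_unique:
  assumes "x \<in> carrier B" "y \<in> carrier B" "z \<in> carrier B"
    and "x \<sqinter> y = \<bottom>" "x \<squnion> y = \<top>" "x \<sqinter> z = \<bottom>" "x \<squnion> z = \<top>"
  shows "y = z"
proof -
  have le: "u \<sqsubseteq> w" if "u \<in> carrier B" "w \<in> carrier B" "x \<squnion> w = \<top>" "x \<sqinter> u = \<bottom>" for u w
  proof -
    have xu: "u \<sqinter> x = \<bottom>" using that by (simp add: meet_comm)
    have "u = u \<sqinter> (x \<squnion> w)"
      using that le_iff_join[of u "\<top>"] by simp
    also have "\<dots> = (u \<sqinter> x) \<squnion> (u \<sqinter> w)"
      using that assms(1) distrib by blast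
    also have "\<dots> = u \<sqinter> w"
      using that le_iff_meet[of "\<bottom>" "u \<sqinter> w"] by (simp add: xu)
    finally show ?thesis using that le_iff_join by blast
  qed
  show ?thesis using assms le by (blast intro: le_antisym)
qed

lemma compl_props:
  assumes "x \<in> carrier B"
  shows "compl x \<in> carrier B" "x \<sqinter> compl x = \<bottom>" "x \<squnion> compl x = \<top>"
proof -
  obtain y where y: "y \<in> carrier B" "x \<sqinter> y = \<bottom>" "x \<squnion> y = \<top>"
    using complement_exists[OF assms] by blast
  have "compl x = y"
    unfolding compl_def
  proof (rule the_equality)
    fix z
    assume "z \<in> carrier B \<and> x \<sqinter> z = \<bottom> \<and> x \<squnion> z = \<top>"
    then show "z = y" using compl_unique[OF assms, of z y] y by simp
  qed (simp add: y)
  then show "compl x \<in> carrier B" "x \<sqinter> compl x = \<bottom>" "x \<squnion> compl x = \<top>"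
    using y by simp_all
qed

end

locale Boolean_valued_model =
  ZFC_universe mem + complete_Boolean_algebra B
  for mem :: "'v \<Rightarrow> 'v \<Rightarrow> bool"  (infix \<open>\<epsilon>\<close> 50) and B :: "'v gorder"  (structure) +
  assumes carrier_is_set: "\<exists>c. \<forall>x. x \<epsilon> c \<longleftrightarrow> x \<in> carrier B"
begin

function VB_stage :: "'v \<Rightarrow> 'v set"
  where "VB_stage \<alpha> =
    {x. is_function x \<and> ran x \<subseteq> carrier B \<and> (\<exists>\<xi> \<in> {\<xi>. \<xi> \<epsilon> \<alpha>}. dom x \<subseteq> VB_stage \<xi>)}"
  by auto
termination
  by (relation mem_rel) (auto simp: wf_mem_rel)

definition VB :: "'v set"
  where "VB = (\<Union>\<alpha> \<in> {\<alpha>. Ord \<alpha>}. VB_stage \<alpha>)"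

text \<open>
  \<open>bv_mem u v\<close> and \<open>bv_eq u v\<close> are the Boolean values of \<open>u \<in> v\<close> and \<open>u = v\<close>.
\<close>

function bv_mem :: "'v \<Rightarrow> 'v \<Rightarrow> 'v" and bv_eq :: "'v \<Rightarrow> 'v \<Rightarrow> 'v"
  where
    "bv_mem u v = \<Squnion> ((\<lambda>x. app v x \<sqinter> bv_eq x u) ` dom v)"
  | "bv_eq u v =
       \<Sqinter> ((\<lambda>x. impl (app u x) (bv_mem x v)) ` dom u) \<sqinter>
       \<Sqinter> ((\<lambda>y. impl (app v y) (bv_mem y u)) ` dom v)"
  by pat_completeness auto
termination
proof (relation "inv_image (mult (mem_rel\<^sup>+))
    (case_sum (\<lambda>(u, v). {#u, v#}) (\<lambda>(u, v). {#u, v#}))", goal_cases)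
  case 1
  show ?case by (intro wf_inv_image wf_mult wf_trancl wf_mem_rel)
next
  case (2 u v x)
  then have "({#u#} + {#x#}, {#u#} + {#v#}) \<in> mult (mem_rel\<^sup>+)"
    by (intro one_step_implies_mult) (auto dest: dom_mem_rel)
  then show ?case by (simp add: add_mset_commute)
next
  case (3 u v x)
  then have "({#v#} + {#x#}, {#v#} + {#u#}) \<in> mult (mem_rel\<^sup>+)"
    by (intro one_step_implies_mult) (auto dest: dom_mem_rel)
  then show ?case by (simp add: add_mset_commute)
next
  case (4 u v y)
  then have "({#u#} + {#y#}, {#u#} + {#v#}) \<in> mult (mem_rel\<^sup>+)"
    by (intro one_step_implies_mult) (auto dest: dom_mem_rel)
  then show ?case by (simp add: add_mset_commute)
qed

declare VB_stage.simps [simp del] bv_mem.simps [simp del] bv_eq.simps [simp del]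

text \<open>
  A formula with constants from \<open>VB\<close> is given as a parameter-free formula together with an
  assignment of elements of \<open>VB\<close> to its variables.
\<close>

primrec bv :: "fm \<Rightarrow> (nat \<Rightarrow> 'v) \<Rightarrow> 'v"
  where
    "bv (Mem i j) e = bv_mem (e i) (e j)"
  | "bv (Eq i j) e = bv_eq (e i) (e j)"
  | "bv (Neg p) e = compl (bv p e)"
  | "bv (And p q) e = bv p e \<sqinter> bv q e"
  | "bv (Or p q) e = bv p e \<squnion> bv q e"
  | "bv (Imp p q) e = impl (bv p e) (bv q e)"
  | "bv (All i p) e = \<Sqinter> ((\<lambda>u. bv p (e(i := u))) ` VB)"
  | "bv (Ex i p) e = \<Squnion> ((\<lambda>u. bv p (e(i := u))) ` VB)"

text \<open>The assignment is irrelevant for sentences; the empty name is an arbitrary choice.\<close>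

definition bv_sentence :: "sentence \<Rightarrow> 'v"
  where "bv_sentence p = bv (Rep_sentence p) (\<lambda>_. empty)"

lemma bv_cong: "(\<And>i. i \<in> free_vars p \<Longrightarrow> e i = e' i) \<Longrightarrow> bv p e = bv p e'"
proof (induction p arbitrary: e e')
  case (All i p)
  have "bv p (e(i := u)) = bv p (e'(i := u))" for u
    by (rule All.IH) (use All.prems in auto)
  then show ?case by simp
next
  case (Ex i p)
  have "bv p (e(i := u)) = bv p (e'(i := u))" for u
    by (rule Ex.IH) (use Ex.prems in auto)
  then show ?case by simp
next
  case (Neg p)
  have "bv p e = bv p e'"
    by (rule Neg.IH) (use Neg.prems in simp)
  then show ?case by simp
next
  case (And p q)
  have "bv p e = bv p e'" "bv q e = bv q e'"
    by (rule And.IH; use And.prems in simp)+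
  then show ?case by simp
next
  case (Or p q)
  have "bv p e = bv p e'" "bv q e = bv q e'"
    by (rule Or.IH; use Or.prems in simp)+
  then show ?case by simp
next
  case (Imp p q)
  have "bv p e = bv p e'" "bv q e = bv q e'"
    by (rule Imp.IH; use Imp.prems in simp)+
  then show ?case by simp
qed simp_all

lemma bv_sentence_eq: "bv_sentence p = bv (Rep_sentence p) e"
  unfolding bv_sentence_def using Rep_sentence[of p] by (intro bv_cong) simp

lemma empty_in_VB: "empty \<in> VB"
proof -
  have fn: "is_function empty" "dom empty = {}" "ran empty = {}"
    by (auto simp: is_function_def dom_def ran_def empty_iff)
  have "Ord (upair empty empty)"
    by (auto simp: Ord_def transitive_def upair_iff empty_iff)
  moreover have "empty \<in> VB_stage (upair empty empty)"
    using fn by (subst VB_stage.simps) (auto simp: upair_iff)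
  ultimately show ?thesis by (auto simp: VB_def)
qed


section \<open>The internal modal semantics\<close>

definition compat :: "'v \<Rightarrow> 'v \<Rightarrow> bool"
  where "compat a b \<longleftrightarrow> a \<sqinter> b \<noteq> \<bottom>"

primrec sat :: "'v \<Rightarrow> modal \<Rightarrow> bool"
  where
    "sat b (Atom p) \<longleftrightarrow> b \<sqsubseteq> bv_sentence p"
  | "sat b (MNeg \<phi>) \<longleftrightarrow> \<not> sat b \<phi>"
  | "sat b (MAnd \<phi> \<psi>) \<longleftrightarrow> sat b \<phi> \<and> sat b \<psi>"
  | "sat b (MOr \<phi> \<psi>) \<longleftrightarrow> sat b \<phi> \<or> sat b \<psi>"
  | "sat b (MImp \<phi> \<psi>) \<longleftrightarrow> (sat b \<phi> \<longrightarrow> sat b \<psi>)"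
  | "sat b (Box \<phi>) \<longleftrightarrow> (\<forall>a \<in> carrier B. compat b a \<longrightarrow> sat a \<phi>)"
  | "sat b (Dia \<phi>) \<longleftrightarrow> (\<exists>a \<in> carrier B. compat b a \<and> sat a \<phi>)"

definition T_H :: "modal set"
  where "T_H = {\<phi>. \<forall>b \<in> carrier B. sat b \<phi>}"

end

end

(* The compatibility relation is symmetric, and symmetry is all that the frame conditions need.
   If b R a and a forces \<box>\<phi>, then a R b, so b forces \<phi>: this is (5 star). Then (.2) is (5 star) followed
   by (B), and (DM) is (5 star) with a superfluous antecedent. *)
theory Submission
  imports Defs
begin

context Boolean_valued_model
begin

text \<open>The meet is the infimum of the unordered pair \<open>{a, b}\<close>, so symmetry holds
  for arbitrary \<open>a\<close> and \<open>b\<close>, inside the carrier or not.\<close>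

lemma compat_commute: "compat a b \<longleftrightarrow> compat b a"
  by (simp add: compat_def meet_comm)

lemma K_in_T_H: "\<^bold>\<box> (\<phi> \<^bold>\<longrightarrow> \<psi>) \<^bold>\<longrightarrow> (\<^bold>\<box> \<phi> \<^bold>\<longrightarrow> \<^bold>\<box> \<psi>) \<in> T_H"
  by (simp add: T_H_def)

text \<open>Negation is classical at each state, so this is De Morgan for the quantifiers over
  accessible states.\<close>

lemma Dual_in_T_H: "(\<^bold>\<not> \<^bold>\<diamond> \<phi> \<^bold>\<longleftrightarrow> \<^bold>\<box> \<^bold>\<not> \<phi>) \<in> T_H"
  by (auto simp: T_H_def)

text \<open>If \<open>b\<close> satisfies \<open>\<phi>\<close> and \<open>compat b a\<close>, then
  \<open>compat a b\<close>, so \<open>b\<close> itself witnesses the diamond at \<open>a\<close>.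
  At the bottom state no \<open>a\<close> is accessible and the box is vacuous.\<close>

lemma B_in_T_H: "\<phi> \<^bold>\<longrightarrow> \<^bold>\<box> \<^bold>\<diamond> \<phi> \<in> T_H"
  using compat_commute by (auto simp: T_H_def)

lemma five_star_in_T_H: "\<^bold>\<diamond> \<^bold>\<box> \<phi> \<^bold>\<longrightarrow> \<phi> \<in> T_H"
  using compat_commute by (auto simp: T_H_def)

lemma dot2_in_T_H: "\<^bold>\<diamond> \<^bold>\<box> \<phi> \<^bold>\<longrightarrow> \<^bold>\<box> \<^bold>\<diamond> \<phi> \<in> T_H"
  \<comment> \<open>Only the clause for implication is unfolded: modal subformulas stay opaque, and
    the two implications are chained at each state.\<close>
  using five_star_in_T_H[of \<phi>] B_in_T_H[of \<phi>] unfolding T_H_def mem_Collect_eq sat.simps(5) by blast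

lemma DM_in_T_H: "\<^bold>\<box> (\<^bold>\<box> (\<phi> \<^bold>\<longrightarrow> \<^bold>\<box> \<phi>) \<^bold>\<longrightarrow> \<phi>) \<^bold>\<longrightarrow> (\<^bold>\<diamond> \<^bold>\<box> \<phi> \<^bold>\<longrightarrow> \<phi>) \<in> T_H"
  \<comment> \<open>Again the boxes stay folded, so the step is purely propositional at each
    state.\<close>
  using five_star_in_T_H[of \<phi>] unfolding T_H_def mem_Collect_eq sat.simps(5) by blast

end

theorem theorem4p1:
  fixes mem :: "'v \<Rightarrow> 'v \<Rightarrow> bool" and B :: "'v gorder"
  assumes "Boolean_valued_model mem B"
  defines "T \<equiv> Boolean_valued_model.T_H mem B"
  shows "\<forall>\<phi> \<psi>.
      \<^bold>\<box> (\<phi> \<^bold>\<longrightarrow> \<psi>) \<^bold>\<longrightarrow> (\<^bold>\<box> \<phi> \<^bold>\<longrightarrow> \<^bold>\<box> \<psi>) \<in> T \<and>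
      (\<^bold>\<not> \<^bold>\<diamond> \<phi> \<^bold>\<longleftrightarrow> \<^bold>\<box> \<^bold>\<not> \<phi>) \<in> T \<and>
      \<phi> \<^bold>\<longrightarrow> \<^bold>\<box> \<^bold>\<diamond> \<phi> \<in> T \<and>
      \<^bold>\<diamond> \<^bold>\<box> \<phi> \<^bold>\<longrightarrow> \<^bold>\<box> \<^bold>\<diamond> \<phi> \<in> T \<and>
      \<^bold>\<diamond> \<^bold>\<box> \<phi> \<^bold>\<longrightarrow> \<phi> \<in> T \<and>
      \<^bold>\<box> (\<^bold>\<box> (\<phi> \<^bold>\<longrightarrow> \<^bold>\<box> \<phi>) \<^bold>\<longrightarrow> \<phi>) \<^bold>\<longrightarrow> (\<^bold>\<diamond> \<^bold>\<box> \<phi> \<^bold>\<longrightarrow> \<phi>) \<in> T"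
proof -
  interpret Boolean_valued_model mem B by fact
  show ?thesis
    unfolding T_def
    by (intro allI conjI K_in_T_H Dual_in_T_H B_in_T_H dot2_in_T_H five_star_in_T_H DM_in_T_H)
qed

end
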